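(* Let $a,b_1,b_2,\mu,m,s$ be real parameters with $b_1>0$, $b_2\ge 0$, $\mu>0$, $m\ge 0$, $0\le s<1$, put $z=\ln\!\big(1/(1-s)\big)$, and assume $\dfrac{a\mu-b_2z}{\mu b_1}\ge m$. Consider the optimization problem (P1): maximize $\bar\lambda\,(p-m)$ over real $(\lambda,p,l,\bar\lambda)$ subject to $$\lambda\le a-b_1p-b_2l,\qquad 1-e^{-\mu l}\ge s,\qquad \rho=\frac{\lambda}{\mu},\qquad P_1=\frac{\rho}{1+\rho},\qquad \bar\lambda=\lambda(1-P_1),\qquad \lambda,p,l,\bar\lambda\ge 0.$$ Then the maximum is attained at the demand, lead-time and price $$\lambda^*=-\mu+\sqrt{\mu^2+a\mu-b_2z-m\mu b_1},\qquad l^*=\frac{\ln(1/(1-s))}{\mu},\qquad p^*=\frac{a-b_2l^*-\lambda^*}{b_1}$$ (with $\bar\lambda$ determined by $\lambda^*$ through the equality constraints), and the maximal value of the objective is $$\frac{\lambda^*\mu}{\mu+\lambda^*}\,(p^*-m).$$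
   Context: The problem (P1) models a make-to-order firm as an M/M/1/1 queue (an arriving customer is rejected if one customer is already in the system) without holding or lateness penalty costs. Decision variables: $p$ is the price, $l$ the quoted lead-time, $\lambda$ the mean arrival rate (demand), $\bar\lambda$ the throughput rate (effective demand). Parameters: $a$ is the market potential, $b_1$ the price sensitivity and $b_2$ the lead-time sensitivity of demand, $\mu$ the mean service rate, $m$ the unit direct variable cost, $s$ the required service level. $P_1$ is the probability that a customer is rejected. The constraint $1-e^{-\mu l}\ge s$ expresses that the probability that the actual lead-time is at most $l$ is at least $s$. *)

theory Defs
  imports Complex_Main
begin

definition utilization :: "real \<Rightarrow> real \<Rightarrow> real" where
  "utilization \<mu> lam = lam / \<mu>"

text \<open>Stationary probability that an M/M/1/1 queue with utilization \<open>\<rho>\<close> is occupied,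
  i.e. that an arriving customer is rejected.\<close>

definition rejection_prob :: "real \<Rightarrow> real" where
  "rejection_prob \<rho> = \<rho> / (1 + \<rho>)"

definition throughput :: "real \<Rightarrow> real \<Rightarrow> real" where
  "throughput \<mu> lam = lam * (1 - rejection_prob (utilization \<mu> lam))"

text \<open>A decision is a tuple (demand rate, price, quoted lead-time, throughput rate).
  The auxiliary quantities \<open>\<rho>\<close> and \<open>P\<^sub>1\<close> of the equality constraints
  are eliminated through \<open>throughput\<close>.\<close>

definition feasible ::
    "real \<Rightarrow> real \<Rightarrow> real \<Rightarrow> real \<Rightarrow> real \<Rightarrow> real \<times> real \<times> real \<times> real \<Rightarrow> bool" where
  "feasible a b1 b2 \<mu> s = (\<lambda>(lam, p, l, lam_bar).
     lam \<le> a - b1 * p - b2 * l \<and>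
     1 - exp (- \<mu> * l) \<ge> s \<and>
     lam_bar = throughput \<mu> lam \<and>
     lam \<ge> 0 \<and> p \<ge> 0 \<and> l \<ge> 0 \<and> lam_bar \<ge> 0)"

definition profit :: "real \<Rightarrow> real \<times> real \<times> real \<times> real \<Rightarrow> real" where
  "profit m = (\<lambda>(lam, p, l, lam_bar). lam_bar * (p - m))"

end

theory Submission
  imports Defs
begin

text \<open>
  The service constraint says that \<open>l\<close> is at least \<open>l* = z / \<mu>\<close>, so the price is at most
  \<open>m + (K - \<lambda>) / b\<^sub>1\<close> with \<open>K = a - b\<^sub>2 l* - m b\<^sub>1\<close>, and the profit is at most
  \<open>\<lambda> \<mu> / (\<mu> + \<lambda>) \<cdot> (K - \<lambda>) / b\<^sub>1\<close>. The demand \<open>x = \<lambda>*\<close> is the nonnegative root of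
  \<open>x\<^sup>2 + 2 \<mu> x = \<mu> K\<close>; eliminating \<open>K\<close> by this equation gives
  \<open>x\<^sup>2 (\<mu> + \<lambda>) - \<lambda> \<mu> (K - \<lambda>) = \<mu> (\<lambda> - x)\<^sup>2\<close>, so that \<open>x\<^sup>2 / b\<^sub>1\<close> bounds the profit, and it is
  attained at \<open>\<lambda> = x\<close>.
\<close>

lemma throughput_eq:
  assumes "\<mu> > 0" and "lam \<ge> 0"
  shows "throughput \<mu> lam = lam * \<mu> / (\<mu> + lam)"
proof -
  have "1 + lam / \<mu> > 0" "\<mu> + lam > 0"
    using assms by (simp_all add: add_pos_nonneg)
  then show ?thesis
    using assms by (simp add: throughput_def rejection_prob_def utilization_def divide_simps)
qed

text \<open>Taking logarithms is legitimate because \<open>1 - s\<close> is positive. Both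
  directions matter: one makes the shortest lead-time feasible, the other bounds every feasible
  lead-time from below.\<close>

lemma service_level_iff:
  fixes \<mu> s l :: real
  assumes "\<mu> > 0" and "s < 1"
  shows "1 - exp (- \<mu> * l) \<ge> s \<longleftrightarrow> ln (1 / (1 - s)) / \<mu> \<le> l"
proof -
  have "1 - exp (- \<mu> * l) \<ge> s \<longleftrightarrow> exp (- \<mu> * l) \<le> 1 - s"
    by auto
  also have "\<dots> \<longleftrightarrow> - \<mu> * l \<le> ln (1 - s)"
    using assms by (simp add: ln_ge_iff)
  also have "\<dots> \<longleftrightarrow> ln (1 / (1 - s)) / \<mu> \<le> l"
    using assms by (auto simp: ln_div field_simps)
  finally show ?thesis .
qed

lemma throughput_margin_le:
  fixes \<mu> K x lam :: real
  assumes "\<mu> > 0" and "lam \<ge> 0" and root: "x\<^sup>2 + 2 * \<mu> * x = \<mu> * K"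
  shows "lam * \<mu> / (\<mu> + lam) * (K - lam) \<le> x\<^sup>2"
proof -
  \<comment> \<open>Leaving \<open>\<mu> * K - \<mu> * lam\<close> unfactored exposes
    \<open>\<mu> * K\<close>, which the root equation turns into a polynomial in \<open>x\<close>;
    only a polynomial identity remains.\<close>
  have "x\<^sup>2 * (\<mu> + lam) - lam * (\<mu> * K - \<mu> * lam) = \<mu> * (lam - x)\<^sup>2"
    unfolding root[symmetric] by (simp add: power2_eq_square algebra_simps)
  moreover have "\<mu> * (lam - x)\<^sup>2 \<ge> 0"
    using assms by simp
  ultimately have "lam * (\<mu> * K - \<mu> * lam) \<le> x\<^sup>2 * (\<mu> + lam)"
    by linarith
  moreover have "\<mu> + lam > 0"
    using assms by simp
  ultimately show ?thesis
    by (simp add: pos_divide_le_eq algebra_simps)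
qed

theorem proposition2:
  fixes a b1 b2 \<mu> m s z lam_opt l_opt p_opt :: real
  assumes "b1 > 0" and "b2 \<ge> 0" and "\<mu> > 0" and "m \<ge> 0" and "0 \<le> s" and "s < 1"
    and "z = ln (1 / (1 - s))"
    and "(a * \<mu> - b2 * z) / (\<mu> * b1) \<ge> m"
    and "lam_opt = - \<mu> + sqrt (\<mu>^2 + a * \<mu> - b2 * z - m * \<mu> * b1)"
    and "l_opt = ln (1 / (1 - s)) / \<mu>"
    and "p_opt = (a - b2 * l_opt - lam_opt) / b1"
  shows "is_arg_max (profit m) (feasible a b1 b2 \<mu> s)
           (lam_opt, p_opt, l_opt, throughput \<mu> lam_opt)
       \<and> profit m (lam_opt, p_opt, l_opt, throughput \<mu> lam_opt)
           = lam_opt * \<mu> / (\<mu> + lam_opt) * (p_opt - m)"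
proof -
  note b1 = assms(1) and b2 = assms(2) and \<mu> = assms(3) and m = assms(4)
    and s = assms(5,6) and z = assms(7)
  define K where "K = a - b2 * l_opt - m * b1"
  have l_opt: "l_opt = z / \<mu>"
    using assms(10) z by simp
  have \<mu>K: "\<mu> * K = a * \<mu> - b2 * z - m * \<mu> * b1"
    using \<mu> by (simp add: K_def l_opt algebra_simps)
  \<comment> \<open>The assumed bound on \<open>m\<close>, with its positive denominator cleared. It
    forces the square root up to at least \<mu>, hence nonnegative demand.\<close>
  have "\<mu> * K \<ge> 0"
    unfolding \<mu>K using assms(8) b1 \<mu> by (simp add: pos_le_divide_eq algebra_simps)
  have lam_opt: "lam_opt = - \<mu> + sqrt (\<mu>\<^sup>2 + \<mu> * K)"
    using assms(9) \<mu>K by (simp add: algebra_simps)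
  have "sqrt (\<mu>\<^sup>2 + \<mu> * K) \<ge> \<mu>"
    using \<open>\<mu> * K \<ge> 0\<close> by (intro real_le_rsqrt) simp
  then have lam_nonneg: "lam_opt \<ge> 0"
    by (simp add: lam_opt)
  have "(lam_opt + \<mu>)\<^sup>2 = \<mu>\<^sup>2 + \<mu> * K"
    using \<open>\<mu> * K \<ge> 0\<close> by (simp add: lam_opt)
  then have root: "lam_opt\<^sup>2 + 2 * \<mu> * lam_opt = \<mu> * K"
    by (simp add: power2_eq_square algebra_simps)

  have p_opt: "p_opt - m = (K - lam_opt) / b1"
    using b1 assms(11) by (simp add: K_def field_simps)
  \<comment> \<open>The root equation rearranged. It serves twice: for the sign of
    \<open>K - lam_opt\<close>, and to cancel \<open>\<mu> + lam_opt\<close> in the optimal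
    profit.\<close>
  have margin: "\<mu> * (K - lam_opt) = lam_opt * (\<mu> + lam_opt)"
    using root by (simp add: power2_eq_square algebra_simps)
  moreover have "lam_opt * (\<mu> + lam_opt) \<ge> 0"
    using lam_nonneg \<mu> by simp
  ultimately have "K - lam_opt \<ge> 0"
    using \<mu> by (metis zero_le_mult_iff not_less)
  \<comment> \<open>Together with \<open>m \<ge> 0\<close> this supplies the sign constraint on the
    price.\<close>
  then have "p_opt \<ge> m"
    using p_opt b1 by (metis divide_nonneg_pos diff_ge_0_iff_ge)

  have profit_opt: "profit m (lam_opt, p_opt, l_opt, throughput \<mu> lam_opt)
      = lam_opt * \<mu> / (\<mu> + lam_opt) * (p_opt - m)"
    using \<mu> lam_nonneg by (simp add: profit_def throughput_eq)
  have "lam_opt * \<mu> / (\<mu> + lam_opt) * (p_opt - m)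
      = lam_opt * (\<mu> * (K - lam_opt)) / ((\<mu> + lam_opt) * b1)"
    by (simp add: p_opt)
  also have "\<dots> = lam_opt\<^sup>2 / b1"
    using \<mu> lam_nonneg unfolding margin by (simp add: power2_eq_square)
  finally have profit_opt_sq: "profit m (lam_opt, p_opt, l_opt, throughput \<mu> lam_opt) = lam_opt\<^sup>2 / b1"
    using profit_opt by simp

  have "l_opt \<ge> 0"
    using \<mu> s by (simp add: assms(10))
  moreover have "1 - exp (- \<mu> * l_opt) \<ge> s"
    using service_level_iff[OF \<mu> s(2)] assms(10) by blast
  moreover have "lam_opt \<le> a - b1 * p_opt - b2 * l_opt"
    using b1 by (simp add: assms(11))
  ultimately have feas: "feasible a b1 b2 \<mu> s (lam_opt, p_opt, l_opt, throughput \<mu> lam_opt)"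
    using lam_nonneg \<open>p_opt \<ge> m\<close> m \<mu> by (simp add: feasible_def throughput_eq)

  have "profit m y \<le> lam_opt\<^sup>2 / b1" if y: "feasible a b1 b2 \<mu> s y" for y
  proof -
    obtain lam p l lam_bar where [simp]: "y = (lam, p, l, lam_bar)"
      by (cases y)
    have demand: "lam \<le> a - b1 * p - b2 * l" and lam: "lam \<ge> 0"
      and lam_bar: "lam_bar = throughput \<mu> lam" and "1 - exp (- \<mu> * l) \<ge> s"
      using y by (auto simp: feasible_def)
    then have "l_opt \<le> l"
      using service_level_iff[OF \<mu> s(2)] assms(10) by blast
    \<comment> \<open>A longer quoted lead-time can only lower the price that supports the demand
      \<open>lam\<close>.\<close>
    then have "b2 * l_opt \<le> b2 * l"
      using b2 by (rule mult_left_mono)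
    with demand have "b1 * (p - m) \<le> K - lam"
      by (simp add: K_def algebra_simps)
    then have "p - m \<le> (K - lam) / b1"
      using b1 by (simp add: pos_le_divide_eq mult.commute)
    \<comment> \<open>The throughput is nonnegative, so the bound on the margin may be multiplied by
      it even when \<open>p < m\<close>. The deleted rules keep it a separate factor for
      \<open>mult_left_mono\<close>.\<close>
    then have "profit m y \<le> lam * \<mu> / (\<mu> + lam) * ((K - lam) / b1)"
      using \<mu> lam by (simp add: profit_def lam_bar throughput_eq mult_left_mono del: times_divide_eq_left times_divide_eq_right)
    also have "\<dots> = lam * \<mu> / (\<mu> + lam) * (K - lam) / b1"
      by simp
    also have "\<dots> \<le> lam_opt\<^sup>2 / b1"
      using throughput_margin_le[OF \<mu> lam root] b1 by (intro divide_right_mono) auto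
    finally show ?thesis .
  qed
  then show ?thesis
    using feas profit_opt profit_opt_sq by (simp add: is_arg_max_linorder)
qed

end
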